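(* Let $P$ be a self-adjoint contractive (Markov) operator on $L^2(\nu)$ such that $\nu P=\nu$. The following are equivalent: (i) $\lambda=1$ is not an eigenvalue for the operator $P$ in $L^2(\nu)$; (ii) $\{f:P(f)=f\}\cap L^2(\nu)=0$; (iii) $\displaystyle\lim_{N\to\infty}\frac1N\sum_{n=1}^N P^n(f)=0$ for every $f\in L^2(\nu)$ (in the norm of $L^2(\nu)$); (iv) for any $A,B\in\mathcal B_{\mathrm{fin}}$, $\displaystyle\lim_{N\to\infty}\frac1N\sum_{n=1}^N\rho_n(A\times B)=0$.
   Context: $(V,\mathcal B,\mu)$ is a standard Borel space with a non-atomic $\sigma$-finite measure, $\mathcal B_{\mathrm{fin}}=\{A\in\mathcal B:\mu(A)<\infty\}$, and $d\nu=c\,d\mu$, where $c$ is a Borel function with $0<c<\infty$ $\mu$-a.e. and $\int_A c\,d\mu<\infty$ for all $A\in\mathcal B_{\mathrm{fin}}$. A Markov operator is a positive operator $P$ ($f\ge0\Rightarrow P(f)\ge0$) with $P(\mathbb 1)=\mathbb 1$. The measure $\nu P$ is defined by $(\nu P)(f)=\int_V P(f)\,d\nu$. The symmetric measures $\rho_n$ on $V\times V$ are defined by $$\rho_n(A\times B)=\langle\chi_A,P^n(\chi_B)\rangle_{L^2(\nu)}.$$ *)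

theory Defs
  imports "HOL-Analysis.Analysis"
begin

definition standard_borel :: "'a measure \<Rightarrow> bool" where
  "standard_borel M \<longleftrightarrow>
     (\<exists>T. topspace T = space M \<and> completely_metrizable_space T \<and> second_countable T \<and>
          sets M = sigma_sets (space M) {U. openin T U})"

definition non_atomic :: "'a measure \<Rightarrow> bool" where
  "non_atomic M \<longleftrightarrow>
     (\<forall>A\<in>sets M. 0 < emeasure M A \<longrightarrow>
        (\<exists>B\<in>sets M. B \<subseteq> A \<and> 0 < emeasure M B \<and> emeasure M B < emeasure M A))"

definition B_fin :: "'a measure \<Rightarrow> 'a set set" where
  "B_fin M = {A \<in> sets M. emeasure M A < \<infinity>}"

text \<open>
  The elements of real \<open>L\<^sup>2(\<nu>)\<close> are represented by square-integrable functions;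
  equality of elements of \<open>L\<^sup>2(\<nu>)\<close> is equality \<open>\<nu>\<close>-almost everywhere.
\<close>

definition L2 :: "'a measure \<Rightarrow> ('a \<Rightarrow> real) set" where
  "L2 \<nu> = {f \<in> borel_measurable \<nu>. integrable \<nu> (\<lambda>x. (f x)\<^sup>2)}"

definition L2_inner :: "'a measure \<Rightarrow> ('a \<Rightarrow> real) \<Rightarrow> ('a \<Rightarrow> real) \<Rightarrow> real" where
  "L2_inner \<nu> f g = (LINT x|\<nu>. f x * g x)"

definition L2_norm :: "'a measure \<Rightarrow> ('a \<Rightarrow> real) \<Rightarrow> real" where
  "L2_norm \<nu> f = sqrt (L2_inner \<nu> f f)"

text \<open>The almost everywhere zero functions, i.e. the zero subspace \<open>0\<close> of \<open>L\<^sup>2(\<nu>)\<close>.\<close>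

definition L2_zero :: "'a measure \<Rightarrow> ('a \<Rightarrow> real) set" where
  "L2_zero \<nu> = {f \<in> borel_measurable \<nu>. AE x in \<nu>. f x = 0}"

text \<open>
  When \<open>\<nu>\<close> is infinite, the constant \<open>1\<close> and the indicators of sets of infinite measure
  are not in \<open>L\<^sup>2(\<nu>)\<close>, although \<open>P(1) = 1\<close> and the measure \<open>\<nu>P\<close> refer to them. So \<open>P\<close>
  acts on the sums of a square-integrable and a bounded Borel function,
  and a Markov operator given on a larger space of Borel functions restricts to these.
\<close>

definition op_domain :: "'a measure \<Rightarrow> ('a \<Rightarrow> real) set" where
  "op_domain \<nu> =
     {\<lambda>x. g x + h x | g h. g \<in> L2 \<nu> \<and> h \<in> borel_measurable \<nu> \<and> bounded (h ` space \<nu>)}"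

text \<open>
  Linearity and positivity are required modulo null sets. Together they imply that \<open>P\<close>
  respects equality almost everywhere.
\<close>

definition linear_operator :: "'a measure \<Rightarrow> (('a \<Rightarrow> real) \<Rightarrow> ('a \<Rightarrow> real)) \<Rightarrow> bool" where
  "linear_operator \<nu> P \<longleftrightarrow>
     (\<forall>f\<in>op_domain \<nu>. P f \<in> op_domain \<nu>) \<and>
     (\<forall>f\<in>op_domain \<nu>. \<forall>g\<in>op_domain \<nu>. \<forall>a b.
        AE x in \<nu>. P (\<lambda>y. a * f y + b * g y) x = a * P f x + b * P g x)"

definition positive_operator :: "'a measure \<Rightarrow> (('a \<Rightarrow> real) \<Rightarrow> ('a \<Rightarrow> real)) \<Rightarrow> bool" where
  "positive_operator \<nu> P \<longleftrightarrow> linear_operator \<nu> P \<and>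
     (\<forall>f\<in>op_domain \<nu>. (AE x in \<nu>. 0 \<le> f x) \<longrightarrow> (AE x in \<nu>. 0 \<le> P f x))"

definition markov_operator :: "'a measure \<Rightarrow> (('a \<Rightarrow> real) \<Rightarrow> ('a \<Rightarrow> real)) \<Rightarrow> bool" where
  "markov_operator \<nu> P \<longleftrightarrow> positive_operator \<nu> P \<and> (AE x in \<nu>. P (\<lambda>_. 1) x = 1)"

text \<open>\<open>P\<close> is defined on all of \<open>L\<^sup>2(\<nu>)\<close>, so that self-adjoint means symmetric.\<close>

definition L2_self_adjoint :: "'a measure \<Rightarrow> (('a \<Rightarrow> real) \<Rightarrow> ('a \<Rightarrow> real)) \<Rightarrow> bool" where
  "L2_self_adjoint \<nu> P \<longleftrightarrow>
     (\<forall>f\<in>L2 \<nu>. P f \<in> L2 \<nu>) \<and>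
     (\<forall>f\<in>L2 \<nu>. \<forall>g\<in>L2 \<nu>. L2_inner \<nu> (P f) g = L2_inner \<nu> f (P g))"

definition L2_contractive :: "'a measure \<Rightarrow> (('a \<Rightarrow> real) \<Rightarrow> ('a \<Rightarrow> real)) \<Rightarrow> bool" where
  "L2_contractive \<nu> P \<longleftrightarrow>
     (\<forall>f\<in>L2 \<nu>. P f \<in> L2 \<nu> \<and> L2_norm \<nu> (P f) \<le> L2_norm \<nu> f)"

text \<open>
  \<open>(\<nu>P)(f)\<close> for functions \<open>f \<ge> 0\<close>; then \<open>P f \<ge> 0\<close> almost everywhere for positive \<open>P\<close>.
  The measure \<open>\<nu>P\<close> of a set is the value at its indicator function.
\<close>

definition measure_op ::
    "'a measure \<Rightarrow> (('a \<Rightarrow> real) \<Rightarrow> ('a \<Rightarrow> real)) \<Rightarrow> ('a \<Rightarrow> real) \<Rightarrow> ennreal" where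
  "measure_op \<nu> P f = (\<integral>\<^sup>+x. ennreal (P f x) \<partial>\<nu>)"

definition invariant_measure :: "'a measure \<Rightarrow> (('a \<Rightarrow> real) \<Rightarrow> ('a \<Rightarrow> real)) \<Rightarrow> bool" where
  "invariant_measure \<nu> P \<longleftrightarrow>
     (\<forall>A\<in>sets \<nu>. measure_op \<nu> P (indicator A) = emeasure \<nu> A)"

definition L2_eigenvalue :: "'a measure \<Rightarrow> (('a \<Rightarrow> real) \<Rightarrow> ('a \<Rightarrow> real)) \<Rightarrow> real \<Rightarrow> bool" where
  "L2_eigenvalue \<nu> P r \<longleftrightarrow>
     (\<exists>f\<in>L2 \<nu>. f \<notin> L2_zero \<nu> \<and> (AE x in \<nu>. P f x = r * f x))"

definition harmonic_functions :: "'a measure \<Rightarrow> (('a \<Rightarrow> real) \<Rightarrow> ('a \<Rightarrow> real)) \<Rightarrow> ('a \<Rightarrow> real) set" where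
  "harmonic_functions \<nu> P = {f \<in> op_domain \<nu>. AE x in \<nu>. P f x = f x}"

definition cesaro_mean ::
    "(('a \<Rightarrow> real) \<Rightarrow> ('a \<Rightarrow> real)) \<Rightarrow> nat \<Rightarrow> ('a \<Rightarrow> real) \<Rightarrow> 'a \<Rightarrow> real" where
  "cesaro_mean P N f x = (1 / real N) * (\<Sum>n=1..N. (P ^^ n) f x)"

text \<open>The value \<open>\<rho>\<^sub>n(A \<times> B)\<close> of the symmetric measure \<open>\<rho>\<^sub>n\<close> on a measurable rectangle.\<close>

definition rho :: "'a measure \<Rightarrow> (('a \<Rightarrow> real) \<Rightarrow> ('a \<Rightarrow> real)) \<Rightarrow> nat \<Rightarrow> 'a set \<Rightarrow> 'a set \<Rightarrow> real" where
  "rho \<nu> P n A B = L2_inner \<nu> (indicator A) ((P ^^ n) (indicator B))"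

end

theory Submission
  imports Defs
begin

text \<open>
  Each of the four conditions is equivalent to the absence of nonzero \<open>P\<close>-fixed vectors in
  \<open>L\<^sup>2(\<nu>)\<close>. For (i) and (ii) this is a matter of definitions. For (iii) it follows from the mean
  ergodic theorem: the Cesaro means of \<open>P\<^sup>n f\<close> converge in norm to a fixed vector, and they are
  constant when \<open>f\<close> itself is fixed.

  For a symmetric contraction the mean ergodic theorem (\<open>mean_ergodic\<close>) has a short proof.
  Since \<open>\<langle>P\<^sup>m f, P\<^sup>n f\<rangle> = \<langle>f, P\<^sup>m\<^sup>+\<^sup>n f\<rangle>\<close>, all distances between even iterates are expressed by the
  decreasing sequence \<open>\<parallel>P\<^sup>k f\<parallel>\<^sup>2\<close>. The even iterates are therefore Cauchy
  (\<open>even_iterates_converge\<close>), with a limit \<open>g\<close> that satisfies \<open>P\<^sup>2 g = g\<close>. Averaging two consecutive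
  iterates removes the possible oscillation between \<open>g\<close> and \<open>P g\<close>, so the Cesaro means converge
  to the fixed vector \<open>(g + P g) / 2\<close>. The limit exists by the completeness of \<open>L\<^sup>2(\<nu>)\<close>
  (\<open>L2_complete\<close>).

  Condition (iv) says that \<open>\<langle>s, C\<^sub>N t\<rangle> \<longlonglongrightarrow> 0\<close>, where \<open>C\<^sub>N\<close> is the Cesaro mean, for all indicators
  \<open>s\<close>, \<open>t\<close> of sets of finite \<open>\<mu>\<close>-measure. By \<open>\<sigma>\<close>-finiteness only the zero vector is orthogonal to all
  these indicators. So the limit of \<open>C\<^sub>N t\<close>, which exists by the mean ergodic theorem, is zero.
  A fixed vector \<open>f\<close> then satisfies \<open>\<langle>f, t\<rangle> = \<langle>f, C\<^sub>N t\<rangle> \<longlonglongrightarrow> 0\<close> for every such \<open>t\<close>, hence \<open>f = 0\<close>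
  (\<open>weak_cesaro_vanishes_iff_no_fixed\<close>).

  Elements of \<open>L\<^sup>2(\<nu>)\<close> are functions here, so vector identities hold almost everywhere and the norm
  is a seminorm.
\<close>

section \<open>The semi-inner product space of square-integrable functions\<close>

lemma L2_measurable: "f \<in> L2 \<nu> \<Longrightarrow> f \<in> borel_measurable \<nu>"
  by (simp add: L2_def)

lemma L2_integrable_square: "f \<in> L2 \<nu> \<Longrightarrow> integrable \<nu> (\<lambda>x. (f x)\<^sup>2)"
  by (simp add: L2_def)

lemma L2_integrable_mult:
  assumes "f \<in> L2 \<nu>" "g \<in> L2 \<nu>"
  shows "integrable \<nu> (\<lambda>x. f x * g x)"
proof (rule Bochner_Integration.integrable_bound)
  show "integrable \<nu> (\<lambda>x. (f x)\<^sup>2 + (g x)\<^sup>2)"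
    using assms by (auto intro: L2_integrable_square)
  show "(\<lambda>x. f x * g x) \<in> borel_measurable \<nu>"
    using assms by (intro borel_measurable_times L2_measurable)
  have "\<bar>a * b\<bar> \<le> a\<^sup>2 + b\<^sup>2" for a b :: real
  proof -
    have "2 * (\<bar>a\<bar> * \<bar>b\<bar>) \<le> a\<^sup>2 + b\<^sup>2"
      using sum_squares_bound[of "\<bar>a\<bar>" "\<bar>b\<bar>"] by simp
    moreover have "0 \<le> \<bar>a\<bar> * \<bar>b\<bar>" by simp
    ultimately show ?thesis by (simp only: abs_mult)
  qed
  then show "AE x in \<nu>. norm (f x * g x) \<le> norm ((f x)\<^sup>2 + (g x)\<^sup>2)"
    by simp
qed

lemma L2_lincomb:
  assumes "f \<in> L2 \<nu>" "g \<in> L2 \<nu>"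
  shows "(\<lambda>x. a * f x + b * g x) \<in> L2 \<nu>"
proof -
  have "integrable \<nu> (\<lambda>x. a\<^sup>2 * (f x)\<^sup>2 + 2 * a * b * (f x * g x) + b\<^sup>2 * (g x)\<^sup>2)"
    using assms
    by (intro Bochner_Integration.integrable_add integrable_mult_right
        L2_integrable_square L2_integrable_mult)
  then have "integrable \<nu> (\<lambda>x. (a * f x + b * g x)\<^sup>2)"
    by (simp add: power2_eq_square algebra_simps)
  with assms show ?thesis
    unfolding L2_def by (auto intro!: borel_measurable_add borel_measurable_times)
qed

lemma L2_add: "f \<in> L2 \<nu> \<Longrightarrow> g \<in> L2 \<nu> \<Longrightarrow> (\<lambda>x. f x + g x) \<in> L2 \<nu>"
  using L2_lincomb[of f \<nu> g 1 1] by simp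

lemma L2_diff: "f \<in> L2 \<nu> \<Longrightarrow> g \<in> L2 \<nu> \<Longrightarrow> (\<lambda>x. f x - g x) \<in> L2 \<nu>"
  using L2_lincomb[of f \<nu> g 1 "- 1"] by simp

lemma L2_scale: "f \<in> L2 \<nu> \<Longrightarrow> (\<lambda>x. a * f x) \<in> L2 \<nu>"
  using L2_lincomb[of f \<nu> f a 0] by simp

lemma L2_zero_in_L2: "(\<lambda>x. 0) \<in> L2 \<nu>"
  by (simp add: L2_def)

lemma L2_sum:
  assumes "\<And>i. i \<in> I \<Longrightarrow> f i \<in> L2 \<nu>"
  shows "(\<lambda>x. \<Sum>i\<in>I. f i x) \<in> L2 \<nu>"
  using assms by (induction I rule: infinite_finite_induct) (auto intro: L2_add L2_zero_in_L2)

lemma L2_cong_AE: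
  assumes "f \<in> L2 \<nu>" "g \<in> borel_measurable \<nu>" "AE x in \<nu>. f x = g x"
  shows "g \<in> L2 \<nu>"
proof -
  have "integrable \<nu> (\<lambda>x. (f x)\<^sup>2) \<longleftrightarrow> integrable \<nu> (\<lambda>x. (g x)\<^sup>2)"
    using assms by (intro integrable_cong_AE) (auto dest: L2_measurable)
  with assms show ?thesis by (auto simp: L2_def)
qed

lemma L2_zero_subset: "L2_zero \<nu> \<subseteq> L2 \<nu>"
proof
  fix f assume "f \<in> L2_zero \<nu>"
  then show "f \<in> L2 \<nu>"
    by (intro L2_cong_AE[OF L2_zero_in_L2]) (auto simp: L2_zero_def)
qed

lemma L2_inner_commute: "L2_inner \<nu> f g = L2_inner \<nu> g f"
  by (simp add: L2_inner_def mult.commute)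

lemma L2_inner_lincomb_left:
  assumes "f \<in> L2 \<nu>" "g \<in> L2 \<nu>" "h \<in> L2 \<nu>"
  shows "L2_inner \<nu> (\<lambda>x. a * f x + b * g x) h = a * L2_inner \<nu> f h + b * L2_inner \<nu> g h"
proof -
  have "L2_inner \<nu> (\<lambda>x. a * f x + b * g x) h
      = (LINT x|\<nu>. a * (f x * h x) + b * (g x * h x))"
    unfolding L2_inner_def by (simp add: algebra_simps)
  also have "\<dots> = a * L2_inner \<nu> f h + b * L2_inner \<nu> g h"
    unfolding L2_inner_def using assms by (simp add: L2_integrable_mult)
  finally show ?thesis .
qed

lemma L2_inner_lincomb_right:
  assumes "f \<in> L2 \<nu>" "g \<in> L2 \<nu>" "h \<in> L2 \<nu>"
  shows "L2_inner \<nu> h (\<lambda>x. a * f x + b * g x) = a * L2_inner \<nu> h f + b * L2_inner \<nu> h g"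
  using L2_inner_lincomb_left[OF assms] by (simp add: L2_inner_commute[of \<nu> h])

lemma L2_inner_diff_right:
  "f \<in> L2 \<nu> \<Longrightarrow> g \<in> L2 \<nu> \<Longrightarrow> h \<in> L2 \<nu> \<Longrightarrow>
    L2_inner \<nu> h (\<lambda>x. f x - g x) = L2_inner \<nu> h f - L2_inner \<nu> h g"
  using L2_inner_lincomb_right[of f \<nu> g h 1 "- 1"] by simp

lemma L2_inner_scale_right:
  "L2_inner \<nu> h (\<lambda>x. a * f x) = a * L2_inner \<nu> h f"
  by (simp add: L2_inner_def mult.left_commute)

lemma L2_inner_sum_right:
  assumes "\<And>i. i \<in> I \<Longrightarrow> f i \<in> L2 \<nu>" "h \<in> L2 \<nu>"
  shows "L2_inner \<nu> h (\<lambda>x. \<Sum>i\<in>I. f i x) = (\<Sum>i\<in>I. L2_inner \<nu> h (f i))"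
  using assms by (simp add: L2_inner_def sum_distrib_left L2_integrable_mult)

lemma L2_inner_cong_AE:
  assumes "f \<in> L2 \<nu>" "f' \<in> L2 \<nu>" "g \<in> L2 \<nu>" "g' \<in> L2 \<nu>"
    and "AE x in \<nu>. f x = f' x" "AE x in \<nu>. g x = g' x"
  shows "L2_inner \<nu> f g = L2_inner \<nu> f' g'"
  unfolding L2_inner_def
proof (rule integral_cong_AE)
  show "AE x in \<nu>. f x * g x = f' x * g' x"
    using assms(5,6) by eventually_elim simp
  show "(\<lambda>x. f x * g x) \<in> borel_measurable \<nu>"
    using assms(1,3) by (intro borel_measurable_times L2_measurable)
  show "(\<lambda>x. f' x * g' x) \<in> borel_measurable \<nu>"
    using assms(2,4) by (intro borel_measurable_times L2_measurable)
qed

lemma L2_inner_self_nonneg: "0 \<le> L2_inner \<nu> f f"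
  by (simp add: L2_inner_def)

lemma L2_norm_nonneg: "0 \<le> L2_norm \<nu> f"
  by (simp add: L2_norm_def L2_inner_self_nonneg)

lemma L2_norm_square: "(L2_norm \<nu> f)\<^sup>2 = L2_inner \<nu> f f"
  by (simp add: L2_norm_def L2_inner_self_nonneg)

lemma L2_norm_cong_AE:
  assumes "f \<in> L2 \<nu>" "g \<in> L2 \<nu>" "AE x in \<nu>. f x = g x"
  shows "L2_norm \<nu> f = L2_norm \<nu> g"
  unfolding L2_norm_def using L2_inner_cong_AE[of f \<nu> g f g] assms by simp

lemma L2_norm_eq_0_iff:
  assumes "f \<in> L2 \<nu>"
  shows "L2_norm \<nu> f = 0 \<longleftrightarrow> (AE x in \<nu>. f x = 0)"
  unfolding L2_norm_def L2_inner_def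
  using integral_nonneg_eq_0_iff_AE[OF L2_integrable_mult[OF assms assms]] by simp

lemma L2_norm_scale: "L2_norm \<nu> (\<lambda>x. a * f x) = \<bar>a\<bar> * L2_norm \<nu> f"
proof -
  have "L2_inner \<nu> (\<lambda>x. a * f x) (\<lambda>x. a * f x) = a\<^sup>2 * L2_inner \<nu> f f"
    by (simp add: L2_inner_def power2_eq_square mult_ac flip: integral_mult_right_zero)
  then show ?thesis by (simp add: L2_norm_def real_sqrt_mult)
qed

lemma L2_norm_square_lincomb:
  assumes "f \<in> L2 \<nu>" "g \<in> L2 \<nu>"
  shows "(L2_norm \<nu> (\<lambda>x. a * f x + b * g x))\<^sup>2
    = a\<^sup>2 * (L2_norm \<nu> f)\<^sup>2 + 2 * a * b * L2_inner \<nu> f g + b\<^sup>2 * (L2_norm \<nu> g)\<^sup>2"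
  unfolding L2_norm_square using assms
  by (simp add: L2_inner_lincomb_left L2_inner_lincomb_right L2_lincomb
      L2_inner_commute[of \<nu> g f] power2_eq_square algebra_simps)

text \<open>Expand \<open>0 \<le> \<parallel>b f \<minusplus> a g\<parallel>\<^sup>2\<close> with \<open>a = \<parallel>f\<parallel>\<close> and \<open>b = \<parallel>g\<parallel>\<close>, and divide by \<open>2 a b\<close>.\<close>

lemma L2_Cauchy_Schwarz:
  assumes f: "f \<in> L2 \<nu>" and g: "g \<in> L2 \<nu>"
  shows "\<bar>L2_inner \<nu> f g\<bar> \<le> L2_norm \<nu> f * L2_norm \<nu> g"
proof (cases "L2_norm \<nu> f = 0 \<or> L2_norm \<nu> g = 0")
  case True
  then have "AE x in \<nu>. f x * g x = 0"
    using L2_norm_eq_0_iff[OF f] L2_norm_eq_0_iff[OF g] by auto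
  then have "L2_inner \<nu> f g = 0"
    unfolding L2_inner_def by (rule integral_eq_zero_AE)
  then show ?thesis by (simp add: L2_norm_nonneg)
next
  case False
  let ?a = "L2_norm \<nu> f" and ?b = "L2_norm \<nu> g"
  have pos: "0 < ?a * ?b"
    using False L2_norm_nonneg[of \<nu> f] L2_norm_nonneg[of \<nu> g] by simp
  have bound: "s * L2_inner \<nu> f g \<le> ?a * ?b" if "s = 1 \<or> s = - 1" for s :: real
  proof -
    have "0 \<le> (L2_norm \<nu> (\<lambda>x. ?b * f x + (- s * ?a) * g x))\<^sup>2" by simp
    also have "\<dots> = 2 * (?a * ?b) * (?a * ?b - s * L2_inner \<nu> f g)"
      unfolding L2_norm_square_lincomb[OF f g]
      using that by (auto simp: power2_eq_square algebra_simps)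
    finally show ?thesis
      using pos by (simp add: zero_le_mult_iff)
  qed
  show ?thesis using bound[of 1] bound[of "- 1"] by simp
qed

lemma L2_norm_triangle:
  assumes f: "f \<in> L2 \<nu>" and g: "g \<in> L2 \<nu>"
  shows "L2_norm \<nu> (\<lambda>x. f x + g x) \<le> L2_norm \<nu> f + L2_norm \<nu> g"
proof (rule power2_le_imp_le)
  have "(L2_norm \<nu> (\<lambda>x. f x + g x))\<^sup>2
      = (L2_norm \<nu> f)\<^sup>2 + 2 * L2_inner \<nu> f g + (L2_norm \<nu> g)\<^sup>2"
    using L2_norm_square_lincomb[OF f g, of 1 1] by simp
  also have "\<dots> \<le> (L2_norm \<nu> f + L2_norm \<nu> g)\<^sup>2"
    using L2_Cauchy_Schwarz[OF f g] by (simp add: power2_sum)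
  finally show "(L2_norm \<nu> (\<lambda>x. f x + g x))\<^sup>2 \<le> (L2_norm \<nu> f + L2_norm \<nu> g)\<^sup>2" .
qed (simp add: L2_norm_nonneg)

lemma L2_norm_triangle_diff:
  assumes f: "f \<in> L2 \<nu>" and g: "g \<in> L2 \<nu>"
  shows "L2_norm \<nu> (\<lambda>x. f x - g x) \<le> L2_norm \<nu> f + L2_norm \<nu> g"
  using L2_norm_triangle[OF f L2_scale[OF g, of "- 1"]] L2_norm_scale[of \<nu> "- 1" g] by simp

lemma L2_norm_sum:
  assumes "\<And>i. i \<in> I \<Longrightarrow> f i \<in> L2 \<nu>"
  shows "L2_norm \<nu> (\<lambda>x. \<Sum>i\<in>I. f i x) \<le> (\<Sum>i\<in>I. L2_norm \<nu> (f i))"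
  using assms
proof (induction I rule: infinite_finite_induct)
  case (insert i I)
  have "L2_norm \<nu> (\<lambda>x. f i x + (\<Sum>j\<in>I. f j x))
      \<le> L2_norm \<nu> (f i) + L2_norm \<nu> (\<lambda>x. \<Sum>j\<in>I. f j x)"
    using insert.prems by (intro L2_norm_triangle L2_sum) auto
  with insert show ?case by force
qed (simp_all add: L2_norm_def L2_inner_def)

lemma L2_inner_tendsto:
  assumes "f \<in> L2 \<nu>" "\<And>n. X n \<in> L2 \<nu>" "g \<in> L2 \<nu>"
    and lim: "(\<lambda>n. L2_norm \<nu> (\<lambda>x. X n x - g x)) \<longlonglongrightarrow> 0"
  shows "(\<lambda>n. L2_inner \<nu> f (X n)) \<longlonglongrightarrow> L2_inner \<nu> f g"
proof -
  have "(\<lambda>n. L2_inner \<nu> f (X n) - L2_inner \<nu> f g) \<longlonglongrightarrow> 0"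
  proof (rule Lim_null_comparison)
    show "\<forall>\<^sub>F n in sequentially. norm (L2_inner \<nu> f (X n) - L2_inner \<nu> f g)
        \<le> L2_norm \<nu> f * L2_norm \<nu> (\<lambda>x. X n x - g x)"
      using assms L2_Cauchy_Schwarz[OF \<open>f \<in> L2 \<nu>\<close> L2_diff]
      by (intro always_eventually) (simp flip: L2_inner_diff_right)
    show "(\<lambda>n. L2_norm \<nu> f * L2_norm \<nu> (\<lambda>x. X n x - g x)) \<longlonglongrightarrow> 0"
      using tendsto_mult_right_zero[OF lim] .
  qed
  then show ?thesis by (simp add: LIM_zero_iff)
qed

section \<open>Completeness\<close>

lemma nn_integral_square_eq_L2_norm:
  assumes "f \<in> L2 \<nu>"
  shows "(\<integral>\<^sup>+x. ennreal ((f x)\<^sup>2) \<partial>\<nu>) = ennreal ((L2_norm \<nu> f)\<^sup>2)"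
  using nn_integral_eq_integral[OF L2_integrable_square[OF assms]]
  unfolding L2_norm_square by (simp add: L2_inner_def power2_eq_square)

lemma L2_I_nn_integral:
  assumes "f \<in> borel_measurable \<nu>" and "(\<integral>\<^sup>+x. ennreal ((f x)\<^sup>2) \<partial>\<nu>) < \<infinity>"
  shows "f \<in> L2 \<nu>"
  using assms unfolding L2_def by (auto intro!: integrableI_nonneg)

text \<open>
  On an infinite measure space a bound on the \<open>L\<^sup>2\<close> norm gives none on the integral of \<open>\<bar>D\<^sub>k\<bar>\<close>, so the
  argument stays with squares. The series \<open>\<Sum>\<^sub>k 2\<^sup>k D\<^sub>k\<^sup>2\<close> has integral at most \<open>\<Sum>\<^sub>k 2\<^sup>-\<^sup>k\<close>, so it is
  finite almost everywhere, and it controls \<open>\<Sum>\<^sub>k \<bar>D\<^sub>k\<bar>\<close>.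
\<close>

lemma L2_AE_summable_increments:
  assumes X: "\<And>k. D k \<in> L2 \<nu>" and small: "\<And>k. L2_norm \<nu> (D k) \<le> (1/2) ^ k"
  shows "AE x in \<nu>. summable (\<lambda>k. D k x)"
proof -
  let ?h = "\<lambda>k x. 2 ^ k * (D k x)\<^sup>2"
  have meas: "(\<lambda>x. ennreal (?h k x)) \<in> borel_measurable \<nu>" for k
    using L2_measurable[OF X[of k]] by measurable
  have "(\<integral>\<^sup>+x. ennreal (?h k x) \<partial>\<nu>) \<le> ennreal ((1/2) ^ k)" for k
  proof -
    have "(\<integral>\<^sup>+x. ennreal (?h k x) \<partial>\<nu>) = ennreal (2 ^ k) * (\<integral>\<^sup>+x. ennreal ((D k x)\<^sup>2) \<partial>\<nu>)"
      using L2_measurable[OF X[of k]] by (subst nn_integral_cmult[symmetric]) (auto simp: ennreal_mult)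
    also have "\<dots> = ennreal (2 ^ k * (L2_norm \<nu> (D k))\<^sup>2)"
      by (simp add: nn_integral_square_eq_L2_norm[OF X] ennreal_mult)
    also have "\<dots> \<le> ennreal (2 ^ k * ((1/2) ^ k)\<^sup>2)"
      by (intro ennreal_leI mult_left_mono power_mono small L2_norm_nonneg) simp
    also have "2 ^ k * ((1/2) ^ k)\<^sup>2 = (1/2 :: real) ^ k"
      by (simp add: power2_eq_square power_divide)
    finally show ?thesis .
  qed
  then have "(\<Sum>k. \<integral>\<^sup>+x. ennreal (?h k x) \<partial>\<nu>) \<le> (\<Sum>k. ennreal ((1/2) ^ k))"
    by (intro suminf_le) auto
  also have "\<dots> < \<infinity>"
    by (subst suminf_ennreal2) (auto simp: summable_geometric)
  finally have "(\<integral>\<^sup>+x. (\<Sum>k. ennreal (?h k x)) \<partial>\<nu>) < \<infinity>"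
    by (subst nn_integral_suminf[OF meas])
  then have "AE x in \<nu>. (\<Sum>k. ennreal (?h k x)) \<noteq> \<infinity>"
    using meas by (intro nn_integral_noteq_infinite) auto
  then show ?thesis
  proof eventually_elim
    fix x assume "(\<Sum>k. ennreal (?h k x)) \<noteq> \<infinity>"
    then have "summable (\<lambda>k. ?h k x)"
      by (intro summable_suminf_not_top) auto
    then have "summable (\<lambda>k. ?h k x + (1/2) ^ k)"
      by (intro summable_add) (auto simp: summable_geometric)
    then show "summable (\<lambda>k. D k x)"
    proof (rule summable_comparison_test')
      fix k :: nat
      \<comment> \<open>the AM-GM inequality for \<open>2 ^ k * D\<^sup>2\<close> and \<open>2 ^ (-k)\<close>, whose product is \<open>D\<^sup>2\<close>\<close>
      have "0 \<le> (1/2) ^ k * (2 ^ k * \<bar>D k x\<bar> - 1)\<^sup>2" by simp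
      also have "\<dots> = ?h k x + (1/2) ^ k - 2 * \<bar>D k x\<bar>"
        by (simp add: power2_eq_square field_simps)
      finally have "2 * \<bar>D k x\<bar> \<le> ?h k x + (1/2) ^ k" by simp
      then show "norm (D k x) \<le> ?h k x + (1/2) ^ k" by simp
    qed
  qed
qed

text \<open>
  A subsequence with geometrically small increments converges almost everywhere. Fatou's lemma
  along this subsequence bounds the distance from every late member to the pointwise limit.
\<close>

theorem L2_complete:
  assumes X: "\<And>n. X n \<in> L2 \<nu>"
    and Cauchy: "\<And>\<epsilon>. 0 < \<epsilon> \<Longrightarrow>
      \<exists>M. \<forall>m\<ge>M. \<forall>n\<ge>M. L2_norm \<nu> (\<lambda>x. X m x - X n x) \<le> \<epsilon>"
  obtains g where "g \<in> L2 \<nu>" "(\<lambda>n. L2_norm \<nu> (\<lambda>x. X n x - g x)) \<longlonglongrightarrow> 0"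
proof -
  have "\<exists>M. \<forall>m\<ge>M. \<forall>n\<ge>M. L2_norm \<nu> (\<lambda>x. X m x - X n x) \<le> (1/2) ^ k" for k
    by (rule Cauchy) simp
  then obtain M where M:
    "\<And>k m n. m \<ge> M k \<Longrightarrow> n \<ge> M k \<Longrightarrow> L2_norm \<nu> (\<lambda>x. X m x - X n x) \<le> (1/2) ^ k"
    by metis
  \<comment> \<open>The partial sums dominate \<open>M\<close> and are monotone; repeated indices do no harm.\<close>
  define r where "r k = (\<Sum>i\<le>k. M i)" for k
  have r: "M j \<le> r k" if "j \<le> k" for j k
    unfolding r_def using that by (intro member_le_sum) auto
  have "AE x in \<nu>. summable (\<lambda>k. X (r (Suc k)) x - X (r k) x)"
    by (intro L2_AE_summable_increments L2_diff X M r) auto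
  then have conv: "AE x in \<nu>. convergent (\<lambda>k. X (r k) x)"
  proof eventually_elim
    fix x assume "summable (\<lambda>k. X (r (Suc k)) x - X (r k) x)"
    then have "convergent (\<lambda>n. X (r n) x - X (r 0) x)"
      by (simp add: summable_iff_convergent sum_lessThan_telescope[of "\<lambda>k. X (r k) x"])
    then show "convergent (\<lambda>k. X (r k) x)"
      using convergent_diff_const_right_iff by blast
  qed
  define g where "g x = lim (\<lambda>k. X (r k) x)" for x
  have Xm: "X n \<in> borel_measurable \<nu>" for n
    using X by (rule L2_measurable)
  have gm: "g \<in> borel_measurable \<nu>"
    unfolding g_def using Xm by (intro borel_measurable_lim_metric)
  have bound: "(\<integral>\<^sup>+x. ennreal ((X n x - g x)\<^sup>2) \<partial>\<nu>) \<le> ennreal (((1/2) ^ j)\<^sup>2)"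
    if n: "n \<ge> M j" for n j
  proof -
    have "(\<integral>\<^sup>+x. ennreal ((X n x - g x)\<^sup>2) \<partial>\<nu>)
        = (\<integral>\<^sup>+x. liminf (\<lambda>k. ennreal ((X n x - X (r k) x)\<^sup>2)) \<partial>\<nu>)"
    proof (rule nn_integral_cong_AE)
      show "AE x in \<nu>. ennreal ((X n x - g x)\<^sup>2)
          = liminf (\<lambda>k. ennreal ((X n x - X (r k) x)\<^sup>2))"
        using conv
      proof eventually_elim
        fix x assume "convergent (\<lambda>k. X (r k) x)"
        then have "(\<lambda>k. X (r k) x) \<longlonglongrightarrow> g x"
          unfolding g_def by (simp add: convergent_LIMSEQ_iff)
        then have "(\<lambda>k. ennreal ((X n x - X (r k) x)\<^sup>2)) \<longlonglongrightarrow> ennreal ((X n x - g x)\<^sup>2)"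
          by (intro tendsto_intros tendsto_ennrealI)
        then show "ennreal ((X n x - g x)\<^sup>2) = liminf (\<lambda>k. ennreal ((X n x - X (r k) x)\<^sup>2))"
          by (intro lim_imp_Liminf[symmetric]) auto
      qed
    qed
    also have "\<dots> \<le> liminf (\<lambda>k. \<integral>\<^sup>+x. ennreal ((X n x - X (r k) x)\<^sup>2) \<partial>\<nu>)"
      using Xm by (intro nn_integral_liminf) measurable
    also have "\<dots> \<le> ennreal (((1/2) ^ j)\<^sup>2)"
    proof (rule Liminf_le)
      have "(\<integral>\<^sup>+x. ennreal ((X n x - X (r k) x)\<^sup>2) \<partial>\<nu>) \<le> ennreal (((1/2) ^ j)\<^sup>2)"
        if "k \<ge> j" for k
        unfolding nn_integral_square_eq_L2_norm[OF L2_diff[OF X X]]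
        using n r[OF that] by (intro ennreal_leI power_mono M L2_norm_nonneg) auto
      then show "\<forall>\<^sub>F k in sequentially.
          (\<integral>\<^sup>+x. ennreal ((X n x - X (r k) x)\<^sup>2) \<partial>\<nu>) \<le> ennreal (((1/2) ^ j)\<^sup>2)"
        by (auto simp: eventually_sequentially)
    qed simp
    finally show ?thesis .
  qed
  have diff: "(\<lambda>x. X n x - g x) \<in> L2 \<nu>" if "n \<ge> M j" for n j
    using Xm gm bound[OF that] by (intro L2_I_nn_integral) (auto simp: order.strict_trans1)
  have g: "g \<in> L2 \<nu>"
    using L2_diff[OF X[of "M 0"] diff[of 0 "M 0"]] by simp
  have norm_bound: "L2_norm \<nu> (\<lambda>x. X n x - g x) \<le> (1/2) ^ j" if "n \<ge> M j" for n j
  proof (rule power2_le_imp_le)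
    show "(L2_norm \<nu> (\<lambda>x. X n x - g x))\<^sup>2 \<le> ((1/2) ^ j)\<^sup>2"
      using bound[OF that] unfolding nn_integral_square_eq_L2_norm[OF L2_diff[OF X g]]
      by (subst (asm) ennreal_le_iff) simp_all
  qed simp
  have "(\<lambda>n. L2_norm \<nu> (\<lambda>x. X n x - g x)) \<longlonglongrightarrow> 0"
  proof (rule LIMSEQ_I)
    fix \<epsilon> :: real assume "0 < \<epsilon>"
    then obtain j where "(1/2) ^ j < \<epsilon>"
      using real_arch_pow_inv[of \<epsilon> "1/2"] by auto
    then show "\<exists>N. \<forall>n\<ge>N. norm (L2_norm \<nu> (\<lambda>x. X n x - g x) - 0) < \<epsilon>"
      using norm_bound[of j] by (intro exI[of _ "M j"]) (auto simp: L2_norm_nonneg intro: order.strict_trans1)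
  qed
  with g show thesis by (rule that)
qed

section \<open>Iterates of a symmetric contraction\<close>

locale L2_symmetric_contraction =
  fixes \<nu> :: "'a measure" and P :: "('a \<Rightarrow> real) \<Rightarrow> ('a \<Rightarrow> real)"
  assumes maps_L2: "f \<in> L2 \<nu> \<Longrightarrow> P f \<in> L2 \<nu>"
    and linear: "f \<in> L2 \<nu> \<Longrightarrow> g \<in> L2 \<nu> \<Longrightarrow>
      AE x in \<nu>. P (\<lambda>y. a * f y + b * g y) x = a * P f x + b * P g x"
    and symmetric: "f \<in> L2 \<nu> \<Longrightarrow> g \<in> L2 \<nu> \<Longrightarrow> L2_inner \<nu> (P f) g = L2_inner \<nu> f (P g)"
    and contractive: "f \<in> L2 \<nu> \<Longrightarrow> L2_norm \<nu> (P f) \<le> L2_norm \<nu> f"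
begin

lemma AE_P_add:
  "f \<in> L2 \<nu> \<Longrightarrow> g \<in> L2 \<nu> \<Longrightarrow> AE x in \<nu>. P (\<lambda>y. f y + g y) x = P f x + P g x"
  using linear[of f g 1 1] by simp

lemma AE_P_diff:
  "f \<in> L2 \<nu> \<Longrightarrow> g \<in> L2 \<nu> \<Longrightarrow> AE x in \<nu>. P (\<lambda>y. f y - g y) x = P f x - P g x"
  using linear[of f g 1 "- 1"] by simp

lemma AE_P_zero:
  assumes "f \<in> L2 \<nu>" "AE x in \<nu>. f x = 0"
  shows "AE x in \<nu>. P f x = 0"
proof -
  have "L2_norm \<nu> f = 0" using assms by (simp add: L2_norm_eq_0_iff)
  then have "L2_norm \<nu> (P f) = 0"
    using contractive[OF assms(1)] L2_norm_nonneg[of \<nu> "P f"] by simp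
  then show ?thesis using assms(1) by (simp add: L2_norm_eq_0_iff maps_L2)
qed

lemma AE_P_cong:
  assumes "f \<in> L2 \<nu>" "g \<in> L2 \<nu>" "AE x in \<nu>. f x = g x"
  shows "AE x in \<nu>. P f x = P g x"
proof -
  have "AE x in \<nu>. P (\<lambda>y. f y - g y) x = 0"
    using assms by (intro AE_P_zero L2_diff) auto
  with AE_P_diff[OF assms(1,2)] show ?thesis
    by eventually_elim simp
qed

lemma contractive_diff:
  assumes "f \<in> L2 \<nu>" "g \<in> L2 \<nu>"
  shows "L2_norm \<nu> (\<lambda>x. P f x - P g x) \<le> L2_norm \<nu> (\<lambda>x. f x - g x)"
proof -
  have "L2_norm \<nu> (\<lambda>x. P f x - P g x) = L2_norm \<nu> (P (\<lambda>y. f y - g y))"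
    using AE_P_diff[OF assms] assms by (intro L2_norm_cong_AE L2_diff maps_L2) auto
  also have "\<dots> \<le> L2_norm \<nu> (\<lambda>x. f x - g x)"
    using assms by (intro contractive L2_diff)
  finally show ?thesis .
qed

lemma iterate_L2: "f \<in> L2 \<nu> \<Longrightarrow> (P ^^ n) f \<in> L2 \<nu>"
  by (induction n) (auto intro: maps_L2)

lemma iterate_contractive: "f \<in> L2 \<nu> \<Longrightarrow> L2_norm \<nu> ((P ^^ n) f) \<le> L2_norm \<nu> f"
proof (induction n)
  case (Suc n)
  then show ?case
    using contractive[OF iterate_L2[OF Suc.prems, of n]] by simp
qed simp

lemma iterate_symmetric:
  assumes "f \<in> L2 \<nu>" "g \<in> L2 \<nu>"
  shows "L2_inner \<nu> ((P ^^ n) f) g = L2_inner \<nu> f ((P ^^ n) g)"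
  using assms(2)
proof (induction n arbitrary: g)
  case (Suc n)
  have "L2_inner \<nu> ((P ^^ Suc n) f) g = L2_inner \<nu> ((P ^^ n) f) (P g)"
    using assms(1) Suc.prems by (simp add: symmetric iterate_L2)
  also have "\<dots> = L2_inner \<nu> f ((P ^^ Suc n) g)"
    using Suc by (simp add: maps_L2 funpow_swap1)
  finally show ?case .
qed simp

lemma inner_iterates:
  assumes "f \<in> L2 \<nu>"
  shows "L2_inner \<nu> ((P ^^ m) f) ((P ^^ n) f) = L2_inner \<nu> f ((P ^^ (m + n)) f)"
  using assms by (simp add: iterate_symmetric iterate_L2 funpow_add)

lemma AE_iterate_fixed:
  assumes "f \<in> L2 \<nu>" "AE x in \<nu>. P f x = f x"
  shows "AE x in \<nu>. (P ^^ n) f x = f x"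
proof (induction n)
  case (Suc n)
  then have "AE x in \<nu>. P ((P ^^ n) f) x = P f x"
    using assms(1) by (intro AE_P_cong iterate_L2)
  with assms(2) show ?case by eventually_elim simp
qed simp

text \<open>
  Write \<open>b k = \<parallel>P\<^sup>k f\<parallel>\<^sup>2 = \<langle>f, P\<^sup>2\<^sup>k f\<rangle>\<close>. This sequence decreases and so has a limit, while
  symmetry gives \<open>\<parallel>P\<^sup>2\<^sup>m f - P\<^sup>2\<^sup>n f\<parallel>\<^sup>2 = b (2 m) - 2 b (m + n) + b (2 n)\<close>. All three terms
  share one limit, so the even iterates form a Cauchy sequence.
  The restriction to even exponents cannot be dropped: for \<open>P f = - f\<close> the full sequence
  oscillates.
\<close>

lemma even_iterates_converge:
  assumes f: "f \<in> L2 \<nu>"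
  obtains g where "g \<in> L2 \<nu>" "(\<lambda>n. L2_norm \<nu> (\<lambda>x. (P ^^ (2 * n)) f x - g x)) \<longlonglongrightarrow> 0"
proof -
  define b where "b k = (L2_norm \<nu> ((P ^^ k) f))\<^sup>2" for k
  have b_inner: "L2_inner \<nu> ((P ^^ m) f) ((P ^^ n) f) = b k" if "m + n = 2 * k" for m n k
    unfolding b_def L2_norm_square inner_iterates[OF f] using that by (simp add: mult_2)
  have "decseq b"
    unfolding b_def
    by (intro decseq_SucI power_mono L2_norm_nonneg) (simp add: contractive iterate_L2 f)
  then obtain L where L: "b \<longlonglongrightarrow> L"
    using decseq_convergent[of b 0] by (auto simp: b_def)
  have dist: "(L2_norm \<nu> (\<lambda>x. (P ^^ (2 * m)) f x - (P ^^ (2 * n)) f x))\<^sup>2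
      = b (2 * m) - 2 * b (m + n) + b (2 * n)" for m n
    using L2_norm_square_lincomb[OF iterate_L2[OF f] iterate_L2[OF f], of 1 "2 * m" "- 1" "2 * n"]
    by (simp add: b_inner[of "2 * m" "2 * n" "m + n"] b_def)
  show thesis
  proof (rule L2_complete)
    show "(P ^^ (2 * n)) f \<in> L2 \<nu>" for n
      using f by (rule iterate_L2)
    fix \<epsilon> :: real assume "0 < \<epsilon>"
    then have "0 < \<epsilon>\<^sup>2 / 4" by simp
    with L obtain M where M: "\<And>k. k \<ge> M \<Longrightarrow> \<bar>b k - L\<bar> < \<epsilon>\<^sup>2 / 4"
      unfolding LIMSEQ_iff by (metis real_norm_def)
    have "L2_norm \<nu> (\<lambda>x. (P ^^ (2 * m)) f x - (P ^^ (2 * n)) f x) \<le> \<epsilon>"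
      if "m \<ge> M" "n \<ge> M" for m n
    proof (rule power2_le_imp_le)
      show "(L2_norm \<nu> (\<lambda>x. (P ^^ (2 * m)) f x - (P ^^ (2 * n)) f x))\<^sup>2 \<le> \<epsilon>\<^sup>2"
        unfolding dist using M[of "2 * m"] M[of "m + n"] M[of "2 * n"] that
        by (simp add: abs_if split: if_splits)
    qed (use \<open>0 < \<epsilon>\<close> in simp)
    then show "\<exists>M. \<forall>m\<ge>M. \<forall>n\<ge>M.
        L2_norm \<nu> (\<lambda>x. (P ^^ (2 * m)) f x - (P ^^ (2 * n)) f x) \<le> \<epsilon>" by blast
  qed (rule that)
qed

text \<open>The operator \<open>P\<^sup>2\<close> is a contraction that shifts the sequence of even iterates by one place.\<close>

lemma even_limit_fixed:
  assumes f: "f \<in> L2 \<nu>" and g: "g \<in> L2 \<nu>"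
    and lim: "(\<lambda>n. L2_norm \<nu> (\<lambda>x. (P ^^ (2 * n)) f x - g x)) \<longlonglongrightarrow> 0"
  shows "AE x in \<nu>. P (P g) x = g x"
proof -
  let ?e = "\<lambda>n. L2_norm \<nu> (\<lambda>x. (P ^^ (2 * n)) f x - g x)"
  have PPg: "P (P g) \<in> L2 \<nu>" using g by (intro maps_L2)
  have "L2_norm \<nu> (\<lambda>x. P (P g) x - g x) \<le> ?e n + ?e (Suc n)" for n
  proof -
    have it: "(P ^^ k) f \<in> L2 \<nu>" for k using f by (rule iterate_L2)
    have "L2_norm \<nu> (\<lambda>x. (P ^^ (2 * Suc n)) f x - P (P g) x) \<le> ?e n"
      using contractive_diff[OF maps_L2[OF it[of "2 * n"]] maps_L2[OF g]]
        contractive_diff[OF it[of "2 * n"] g] by simp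
    moreover have "L2_norm \<nu> (\<lambda>x. P (P g) x - g x)
        \<le> ?e (Suc n) + L2_norm \<nu> (\<lambda>x. (P ^^ (2 * Suc n)) f x - P (P g) x)"
      using L2_norm_triangle_diff[OF L2_diff[OF it[of "2 * Suc n"] g] L2_diff[OF it[of "2 * Suc n"] PPg]]
      by simp
    ultimately show ?thesis by simp
  qed
  moreover have "(\<lambda>n. ?e n + ?e (Suc n)) \<longlonglongrightarrow> 0 + 0"
    by (rule tendsto_add[OF lim LIMSEQ_Suc[OF lim]])
  ultimately have "L2_norm \<nu> (\<lambda>x. P (P g) x - g x) \<le> 0"
    by (intro LIMSEQ_le_const) auto
  then have "L2_norm \<nu> (\<lambda>x. P (P g) x - g x) = 0"
    using L2_norm_nonneg by (rule antisym)
  then show ?thesis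
    by (simp add: L2_norm_eq_0_iff L2_diff PPg g)
qed

text \<open>
  If the even iterates tend to \<open>g\<close>, the odd ones tend to \<open>P g\<close>, so the sum of two consecutive
  iterates tends to \<open>w = g + P g\<close> for either parity, and \<open>P w = P g + P\<^sup>2 g = w\<close>. It is enough to
  follow even indices, because the distance to the fixed vector \<open>w\<close> decreases.
\<close>

lemma consecutive_iterates_converge:
  assumes f: "f \<in> L2 \<nu>"
  obtains w where "w \<in> L2 \<nu>" "AE x in \<nu>. P w x = w x"
    "(\<lambda>n. L2_norm \<nu> (\<lambda>x. ((P ^^ n) f x + (P ^^ Suc n) f x) - w x)) \<longlonglongrightarrow> 0"
proof -
  obtain g where g: "g \<in> L2 \<nu>"
    and lim: "(\<lambda>n. L2_norm \<nu> (\<lambda>x. (P ^^ (2 * n)) f x - g x)) \<longlonglongrightarrow> 0"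
    using even_iterates_converge[OF f] by blast
  define w where "w x = g x + P g x" for x
  have w: "w \<in> L2 \<nu>" unfolding w_def using g by (intro L2_add maps_L2)
  have it: "(P ^^ n) f \<in> L2 \<nu>" for n using f by (rule iterate_L2)
  have fixed: "AE x in \<nu>. P w x = w x"
    using AE_P_add[OF g maps_L2[OF g]] even_limit_fixed[OF f g lim]
    unfolding w_def[abs_def] by eventually_elim simp
  define u where "u n x = (P ^^ n) f x + (P ^^ Suc n) f x" for n x
  have u: "u n \<in> L2 \<nu>" for n
    unfolding u_def[abs_def] by (intro L2_add it)
  define d where "d n = L2_norm \<nu> (\<lambda>x. u n x - w x)" for n
  have "decseq d"
  proof (rule decseq_SucI)
    fix n
    have "d (Suc n) = L2_norm \<nu> (\<lambda>x. P (u n) x - P w x)"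
      unfolding d_def
    proof (intro L2_norm_cong_AE L2_diff u w maps_L2)
      show "AE x in \<nu>. u (Suc n) x - w x = P (u n) x - P w x"
        using AE_P_add[OF it it, of n "Suc n"] fixed
        unfolding u_def[abs_def] by eventually_elim simp
    qed
    also have "\<dots> \<le> d n"
      unfolding d_def by (intro contractive_diff u w)
    finally show "d (Suc n) \<le> d n" .
  qed
  then obtain l where l: "d \<longlonglongrightarrow> l" and l_le: "\<And>n. l \<le> d n"
    using decseq_convergent[of d 0] by (auto simp: d_def L2_norm_nonneg)
  have even: "d (2 * n) \<le> 2 * L2_norm \<nu> (\<lambda>x. (P ^^ (2 * n)) f x - g x)" for n
  proof -
    have "d (2 * n) = L2_norm \<nu> (\<lambda>x. ((P ^^ (2 * n)) f x - g x) + (P ((P ^^ (2 * n)) f) x - P g x))"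
      unfolding d_def u_def w_def by (simp add: algebra_simps)
    also have "\<dots> \<le> L2_norm \<nu> (\<lambda>x. (P ^^ (2 * n)) f x - g x)
        + L2_norm \<nu> (\<lambda>x. P ((P ^^ (2 * n)) f) x - P g x)"
      by (intro L2_norm_triangle L2_diff it g maps_L2)
    also have "\<dots> \<le> 2 * L2_norm \<nu> (\<lambda>x. (P ^^ (2 * n)) f x - g x)"
      using contractive_diff[OF it g] by simp
    finally show ?thesis .
  qed
  have "l \<le> 2 * L2_norm \<nu> (\<lambda>x. (P ^^ (2 * n)) f x - g x)" for n
    using l_le[of "2 * n"] even[of n] by linarith
  then have "l \<le> 0"
    using LIMSEQ_le_const[OF tendsto_mult_right_zero[OF lim, of 2]] by blast
  moreover have "0 \<le> l"
    using l by (rule LIMSEQ_le_const) (auto simp: d_def L2_norm_nonneg)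
  ultimately have "d \<longlonglongrightarrow> 0" using l by simp
  with w fixed show thesis
    unfolding d_def[abs_def] u_def by (rule that)
qed

section \<open>The mean ergodic theorem\<close>

lemma cesaro_mean_L2: "f \<in> L2 \<nu> \<Longrightarrow> cesaro_mean P N f \<in> L2 \<nu>"
  unfolding cesaro_mean_def[abs_def] by (intro L2_scale L2_sum iterate_L2)

lemma inner_cesaro_mean:
  assumes "f \<in> L2 \<nu>" "g \<in> L2 \<nu>"
  shows "L2_inner \<nu> g (cesaro_mean P N f) = (1 / real N) * (\<Sum>n=1..N. L2_inner \<nu> g ((P ^^ n) f))"
  unfolding cesaro_mean_def[abs_def] using assms
  by (simp only: L2_inner_scale_right L2_inner_sum_right iterate_L2)

end

lemma cesaro_tendsto_0:
  fixes d :: "nat \<Rightarrow> real"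
  assumes lim: "d \<longlonglongrightarrow> 0" and nonneg: "\<And>n. 0 \<le> d n"
  shows "(\<lambda>N. (1 / real N) * (\<Sum>n=1..N. d n)) \<longlonglongrightarrow> 0"
proof (rule LIMSEQ_I)
  fix \<epsilon> :: real assume "0 < \<epsilon>"
  then obtain M where M: "\<And>n. n \<ge> M \<Longrightarrow> d n < \<epsilon> / 2"
    using LIMSEQ_D[OF lim, of "\<epsilon> / 2"] nonneg by auto
  define K where "K = (\<Sum>n=1..M. d n)"
  have sum_le: "(\<Sum>n=1..N. d n) \<le> K + real N * (\<epsilon> / 2)" for N
  proof (induction N)
    case (Suc N)
    show ?case
    proof (cases "Suc N \<le> M")
      case True
      then have "(\<Sum>n=1..Suc N. d n) \<le> K"
        unfolding K_def using nonneg by (intro sum_mono2) auto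
      moreover have "0 \<le> real (Suc N) * (\<epsilon> / 2)"
        using \<open>0 < \<epsilon>\<close> by simp
      ultimately show ?thesis by linarith
    next
      case False
      then have "d (Suc N) < \<epsilon> / 2" by (intro M) simp
      moreover have "real (Suc N) * (\<epsilon> / 2) = real N * (\<epsilon> / 2) + \<epsilon> / 2"
        by (simp add: distrib_right)
      moreover have "(\<Sum>n=1..Suc N. d n) = (\<Sum>n=1..N. d n) + d (Suc N)"
        by simp
      ultimately show ?thesis using Suc by linarith
    qed
  qed (simp add: K_def sum_nonneg nonneg)
  obtain N0 where N0: "2 * K / \<epsilon> < real N0"
    using reals_Archimedean2 by blast
  have "norm ((1 / real N) * (\<Sum>n=1..N. d n) - 0) < \<epsilon>" if "N \<ge> Suc N0" for N
  proof -
    have "2 * K / \<epsilon> < real N" using N0 that by linarith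
    then have "2 * K < real N * \<epsilon>"
      using \<open>0 < \<epsilon>\<close> by (simp only: pos_divide_less_eq)
    then have "(\<Sum>n=1..N. d n) < \<epsilon> * real N"
      using sum_le[of N] by (simp add: mult.commute)
    moreover have "0 \<le> (\<Sum>n=1..N. d n)"
      using nonneg by (intro sum_nonneg)
    moreover have "0 < real N" using that by simp
    ultimately show ?thesis
      by (simp add: pos_divide_less_eq)
  qed
  then show "\<exists>N0. \<forall>N\<ge>N0. norm ((1 / real N) * (\<Sum>n=1..N. d n) - 0) < \<epsilon>" by blast
qed

context L2_symmetric_contraction
begin

text \<open>
  Up to a telescoping boundary term of norm \<open>O(1/N)\<close>, twice the Cesaro mean of \<open>P\<^sup>n f\<close> is the Cesaro
  mean of \<open>P\<^sup>n f + P\<^sup>n\<^sup>+\<^sup>1 f\<close>, and this sequence converges to a fixed vector.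
\<close>

theorem mean_ergodic:
  assumes f: "f \<in> L2 \<nu>"
  obtains h where "h \<in> L2 \<nu>" "AE x in \<nu>. P h x = h x"
    "(\<lambda>N. L2_norm \<nu> (\<lambda>x. cesaro_mean P N f x - h x)) \<longlonglongrightarrow> 0"
proof -
  obtain w where w: "w \<in> L2 \<nu>" and fixed: "AE x in \<nu>. P w x = w x"
    and lim: "(\<lambda>n. L2_norm \<nu> (\<lambda>x. ((P ^^ n) f x + (P ^^ Suc n) f x) - w x)) \<longlonglongrightarrow> 0"
    using consecutive_iterates_converge[OF f] by blast
  define h where "h x = 1 / 2 * w x" for x
  have h: "h \<in> L2 \<nu>" unfolding h_def[abs_def] by (rule L2_scale[OF w])
  have Ph: "AE x in \<nu>. P h x = h x"
    using linear[OF w w, of "1 / 2" 0] fixed unfolding h_def[abs_def]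
    by eventually_elim simp
  have it: "(P ^^ n) f \<in> L2 \<nu>" for n using f by (rule iterate_L2)
  define v where "v n x = ((P ^^ n) f x + (P ^^ Suc n) f x) - w x" for n x
  have v: "v n \<in> L2 \<nu>" for n
    unfolding v_def[abs_def] by (intro L2_diff L2_add it w)
  have v_lim: "(\<lambda>n. L2_norm \<nu> (v n)) \<longlonglongrightarrow> 0"
    using lim unfolding v_def[abs_def] .
  let ?bound = "\<lambda>N. 1 / 2 * ((1 / real N) * (\<Sum>n=1..N. L2_norm \<nu> (v n))) + (1 / real N) * L2_norm \<nu> f"
  have estimate: "L2_norm \<nu> (\<lambda>x. cesaro_mean P N f x - h x) \<le> ?bound N" if N: "N \<ge> 1" for N
  proof -
    have split: "cesaro_mean P N f x - h x
        = 1 / (2 * real N) * (\<Sum>n=1..N. v n x) + 1 / (2 * real N) * (P f x - (P ^^ Suc N) f x)" for x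
    proof -
      have "(\<Sum>n=1..N. v n x) = (\<Sum>n=1..N. (P ^^ n) f x) + (\<Sum>n=1..N. (P ^^ Suc n) f x) - real N * w x"
        by (simp add: v_def sum_subtractf sum.distrib)
      moreover have "(\<Sum>n=1..N. (P ^^ Suc n) f x)
          = (\<Sum>n=1..N. (P ^^ n) f x) + (P ^^ Suc N) f x - P f x"
        by (induction N) simp_all
      ultimately have "(\<Sum>n=1..N. v n x) + (P f x - (P ^^ Suc N) f x)
          = 2 * (\<Sum>n=1..N. (P ^^ n) f x) - real N * w x" by simp
      then have "1 / (2 * real N) * ((\<Sum>n=1..N. v n x) + (P f x - (P ^^ Suc N) f x))
          = 1 / (2 * real N) * (2 * (\<Sum>n=1..N. (P ^^ n) f x) - real N * w x)" by (rule arg_cong)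
      also have "\<dots> = cesaro_mean P N f x - h x"
        using N by (simp add: cesaro_mean_def h_def field_simps)
      finally show ?thesis by (simp only: distrib_left)
    qed
    have "L2_norm \<nu> (\<lambda>x. cesaro_mean P N f x - h x)
        \<le> L2_norm \<nu> (\<lambda>x. 1 / (2 * real N) * (\<Sum>n=1..N. v n x))
          + L2_norm \<nu> (\<lambda>x. 1 / (2 * real N) * (P f x - (P ^^ Suc N) f x))"
      unfolding split by (intro L2_norm_triangle L2_scale L2_sum L2_diff v it maps_L2 f)
    also have "\<dots> = 1 / (2 * real N) * L2_norm \<nu> (\<lambda>x. \<Sum>n=1..N. v n x)
          + 1 / (2 * real N) * L2_norm \<nu> (\<lambda>x. P f x - (P ^^ Suc N) f x)"
      by (simp only: L2_norm_scale) simp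
    also have "\<dots> \<le> 1 / (2 * real N) * (\<Sum>n=1..N. L2_norm \<nu> (v n))
          + 1 / (2 * real N) * (2 * L2_norm \<nu> f)"
    proof (intro add_mono mult_left_mono)
      show "L2_norm \<nu> (\<lambda>x. P f x - (P ^^ Suc N) f x) \<le> 2 * L2_norm \<nu> f"
        using L2_norm_triangle_diff[OF maps_L2[OF f] it[of "Suc N"]] contractive[OF f]
          iterate_contractive[OF f, of "Suc N"] by linarith
    qed (use v in \<open>auto intro: L2_norm_sum\<close>)
    also have "\<dots> = ?bound N" by (simp add: field_simps)
    finally show ?thesis .
  qed
  have "(\<lambda>N. L2_norm \<nu> (\<lambda>x. cesaro_mean P N f x - h x)) \<longlonglongrightarrow> 0"
  proof (rule Lim_null_comparison)
    show "\<forall>\<^sub>F N in sequentially. norm (L2_norm \<nu> (\<lambda>x. cesaro_mean P N f x - h x)) \<le> ?bound N"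
      using estimate by (auto simp: eventually_sequentially L2_norm_nonneg intro!: exI[of _ 1])
    have "(\<lambda>N. (1 / real N) * (\<Sum>n=1..N. L2_norm \<nu> (v n))) \<longlonglongrightarrow> 0"
      by (intro cesaro_tendsto_0 v_lim L2_norm_nonneg)
    then have "?bound \<longlonglongrightarrow> 1 / 2 * 0 + 0 * L2_norm \<nu> f"
      by (intro tendsto_intros lim_1_over_n)
    then show "?bound \<longlonglongrightarrow> 0" by simp
  qed
  with h Ph show thesis by (rule that)
qed

lemma cesaro_mean_vanishes_iff_no_fixed:
  "(\<forall>f\<in>L2 \<nu>. (\<lambda>N. L2_norm \<nu> (cesaro_mean P N f)) \<longlonglongrightarrow> 0) \<longleftrightarrow>
    (\<forall>f\<in>L2 \<nu>. (AE x in \<nu>. P f x = f x) \<longrightarrow> (AE x in \<nu>. f x = 0))"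
  (is "?means \<longleftrightarrow> ?fixed")
proof
  assume means: ?means
  show ?fixed
  proof (intro ballI impI)
    fix f assume f: "f \<in> L2 \<nu>" and Pf: "AE x in \<nu>. P f x = f x"
    have "L2_norm \<nu> (cesaro_mean P N f) = L2_norm \<nu> f" if "N \<ge> 1" for N
    proof (intro L2_norm_cong_AE cesaro_mean_L2 f)
      have "AE x in \<nu>. \<forall>n. (P ^^ n) f x = f x"
        unfolding AE_all_countable using AE_iterate_fixed[OF f Pf] by blast
      then show "AE x in \<nu>. cesaro_mean P N f x = f x"
      proof eventually_elim
        fix x assume "\<forall>n. (P ^^ n) f x = f x"
        then have "cesaro_mean P N f x = (1 / real N) * (\<Sum>n=1..N. f x)"
          unfolding cesaro_mean_def by (simp only:)
        then show "cesaro_mean P N f x = f x" using that by simp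
      qed
    qed
    then have "\<forall>\<^sub>F N in sequentially. L2_norm \<nu> (cesaro_mean P N f) = L2_norm \<nu> f"
      by (rule eventually_sequentiallyI)
    then have "(\<lambda>N. L2_norm \<nu> (cesaro_mean P N f)) \<longlonglongrightarrow> L2_norm \<nu> f"
      by (rule tendsto_eventually)
    moreover have "(\<lambda>N. L2_norm \<nu> (cesaro_mean P N f)) \<longlonglongrightarrow> 0"
      using means f by blast
    ultimately have "L2_norm \<nu> f = 0" by (rule LIMSEQ_unique)
    then show "AE x in \<nu>. f x = 0" using f by (simp add: L2_norm_eq_0_iff)
  qed
next
  assume fixed: ?fixed
  show ?means
  proof
    fix f assume f: "f \<in> L2 \<nu>"
    obtain h where h: "h \<in> L2 \<nu>" and Ph: "AE x in \<nu>. P h x = h x"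
      and lim: "(\<lambda>N. L2_norm \<nu> (\<lambda>x. cesaro_mean P N f x - h x)) \<longlonglongrightarrow> 0"
      using mean_ergodic[OF f] by blast
    have "AE x in \<nu>. h x = 0" using fixed h Ph by blast
    then have "L2_norm \<nu> (\<lambda>x. cesaro_mean P N f x - h x) = L2_norm \<nu> (cesaro_mean P N f)" for N
      by (intro L2_norm_cong_AE L2_diff cesaro_mean_L2 f h) auto
    with lim show "(\<lambda>N. L2_norm \<nu> (cesaro_mean P N f)) \<longlonglongrightarrow> 0" by simp
  qed
qed

text \<open>
  Convergence of the matrix coefficients on a set \<open>S\<close> whose orthogonal complement is zero suffices.
  Approximation by linear combinations of \<open>S\<close> is avoided, because the norm limit of the means is
  known to exist: testing it against \<open>S\<close> shows that it vanishes.
\<close>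

lemma weak_cesaro_vanishes_iff_no_fixed:
  assumes S: "S \<subseteq> L2 \<nu>"
    and total: "\<And>f. f \<in> L2 \<nu> \<Longrightarrow> (\<And>s. s \<in> S \<Longrightarrow> L2_inner \<nu> s f = 0) \<Longrightarrow> AE x in \<nu>. f x = 0"
  shows "(\<forall>s\<in>S. \<forall>t\<in>S. (\<lambda>N. L2_inner \<nu> s (cesaro_mean P N t)) \<longlonglongrightarrow> 0) \<longleftrightarrow>
    (\<forall>f\<in>L2 \<nu>. (AE x in \<nu>. P f x = f x) \<longrightarrow> (AE x in \<nu>. f x = 0))"
  (is "?weak \<longleftrightarrow> ?fixed")
proof
  assume weak: ?weak
  show ?fixed
  proof (intro ballI impI)
    fix f assume f: "f \<in> L2 \<nu>" and Pf: "AE x in \<nu>. P f x = f x"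
    show "AE x in \<nu>. f x = 0"
    proof (rule total[OF f])
      fix t assume t: "t \<in> S"
      then have tL2: "t \<in> L2 \<nu>" using S by blast
      obtain h where h: "h \<in> L2 \<nu>"
        and lim: "(\<lambda>N. L2_norm \<nu> (\<lambda>x. cesaro_mean P N t x - h x)) \<longlonglongrightarrow> 0"
        using mean_ergodic[OF tL2] by blast
      note inner_lim = L2_inner_tendsto[OF _ cesaro_mean_L2[OF tL2] h lim]
      have "AE x in \<nu>. h x = 0"
      proof (rule total[OF h])
        fix s assume s: "s \<in> S"
        then have "(\<lambda>N. L2_inner \<nu> s (cesaro_mean P N t)) \<longlonglongrightarrow> L2_inner \<nu> s h"
          using S by (intro inner_lim) blast
        moreover have "(\<lambda>N. L2_inner \<nu> s (cesaro_mean P N t)) \<longlonglongrightarrow> 0"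
          using weak s t by blast
        ultimately show "L2_inner \<nu> s h = 0" by (rule LIMSEQ_unique)
      qed
      then have "AE x in \<nu>. f x * h x = 0" by eventually_elim simp
      then have fh: "L2_inner \<nu> f h = 0"
        unfolding L2_inner_def by (rule integral_eq_zero_AE)
      \<comment> \<open>Move the iterate to the fixed vector \<open>f\<close>: pairing \<open>f\<close> with any mean of \<open>t\<close> gives \<open>\<langle>f, t\<rangle>\<close>.\<close>
      have "L2_inner \<nu> f ((P ^^ n) t) = L2_inner \<nu> f t" for n
        unfolding iterate_symmetric[OF f tL2, symmetric]
        using AE_iterate_fixed[OF f Pf] by (intro L2_inner_cong_AE iterate_L2 f tL2) auto
      then have "L2_inner \<nu> f (cesaro_mean P N t) = L2_inner \<nu> f t" if "N \<ge> 1" for N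
        using that by (simp add: inner_cesaro_mean tL2 f)
      then have "\<forall>\<^sub>F N in sequentially. L2_inner \<nu> f (cesaro_mean P N t) = L2_inner \<nu> f t"
        by (rule eventually_sequentiallyI)
      then have "(\<lambda>N. L2_inner \<nu> f (cesaro_mean P N t)) \<longlonglongrightarrow> L2_inner \<nu> f t"
        by (rule tendsto_eventually)
      then have "L2_inner \<nu> f t = L2_inner \<nu> f h"
        using inner_lim[OF f] by (rule LIMSEQ_unique)
      with fh show "L2_inner \<nu> t f = 0" by (simp add: L2_inner_commute[of \<nu> t])
    qed
  qed
next
  assume ?fixed
  then have means: "(\<lambda>N. L2_norm \<nu> (cesaro_mean P N t)) \<longlonglongrightarrow> 0" if "t \<in> L2 \<nu>" for t
    using cesaro_mean_vanishes_iff_no_fixed that by blast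
  show ?weak
  proof (intro ballI)
    fix s t assume "s \<in> S" "t \<in> S"
    then have st: "s \<in> L2 \<nu>" "t \<in> L2 \<nu>" using S by blast+
    have "(\<lambda>N. L2_inner \<nu> s (cesaro_mean P N t)) \<longlonglongrightarrow> L2_inner \<nu> s (\<lambda>x. 0)"
      using means[OF st(2)] by (intro L2_inner_tendsto cesaro_mean_L2 st L2_zero_in_L2) simp
    then show "(\<lambda>N. L2_inner \<nu> s (cesaro_mean P N t)) \<longlonglongrightarrow> 0"
      by (simp add: L2_inner_def)
  qed
qed

end

section \<open>Sets of finite measure\<close>

lemma L2_indicator:
  assumes "A \<in> sets \<nu>" "emeasure \<nu> A < \<infinity>"
  shows "indicator A \<in> L2 \<nu>"
proof -
  have "integrable \<nu> (indicator A :: _ \<Rightarrow> real)"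
    using assms by (rule integrable_real_indicator)
  moreover have "(\<lambda>x. (indicator A x :: real)\<^sup>2) = indicator A"
    by (auto simp: indicator_def)
  ultimately show ?thesis using assms unfolding L2_def by simp
qed

text \<open>
  Test \<open>f\<close> against the indicator of \<open>{f > 0} \<inter> A i\<close>: the integral of a nonnegative function vanishes
  only if the function vanishes almost everywhere.
\<close>

lemma AE_nonpos_if_orthogonal_to_indicators:
  assumes f: "f \<in> L2 \<nu>"
    and cover: "range A \<subseteq> sets \<nu>" "(\<Union>i::nat. A i) = space \<nu>" "\<And>i. emeasure \<nu> (A i) < \<infinity>"
    and orth: "\<And>i B. B \<in> sets \<nu> \<Longrightarrow> B \<subseteq> A i \<Longrightarrow> L2_inner \<nu> (indicator B) f = 0"
  shows "AE x in \<nu>. f x \<le> 0"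
proof -
  have "AE x in \<nu>. x \<in> A i \<longrightarrow> f x \<le> 0" for i
  proof -
    define B where "B = {x \<in> space \<nu>. 0 < f x} \<inter> A i"
    have Ai: "A i \<in> sets \<nu>" using cover(1) by auto
    have B: "B \<in> sets \<nu>" "B \<subseteq> A i"
      unfolding B_def using L2_measurable[OF f] Ai by auto
    have "emeasure \<nu> B \<le> emeasure \<nu> (A i)"
      using B(2) Ai by (rule emeasure_mono)
    then have "indicator B \<in> L2 \<nu>"
      using B(1) cover(3)[of i] by (intro L2_indicator) (auto intro: order.strict_trans1)
    then have int: "integrable \<nu> (\<lambda>x. indicator B x * f x)"
      using f by (rule L2_integrable_mult)
    have "AE x in \<nu>. indicator B x * f x = 0"
      using orth[OF B] integral_nonneg_eq_0_iff_AE[OF int]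
      unfolding L2_inner_def B_def by (auto simp: indicator_def)
    with AE_space show ?thesis
      by eventually_elim (auto simp: B_def indicator_def not_le)
  qed
  then have "AE x in \<nu>. \<forall>i. x \<in> A i \<longrightarrow> f x \<le> 0"
    unfolding AE_all_countable by blast
  with AE_space show ?thesis
    by eventually_elim (use cover(2) in blast)
qed

lemma AE_zero_if_orthogonal_to_indicators:
  assumes f: "f \<in> L2 \<nu>"
    and cover: "range A \<subseteq> sets \<nu>" "(\<Union>i::nat. A i) = space \<nu>" "\<And>i. emeasure \<nu> (A i) < \<infinity>"
    and orth: "\<And>i B. B \<in> sets \<nu> \<Longrightarrow> B \<subseteq> A i \<Longrightarrow> L2_inner \<nu> (indicator B) f = 0"
  shows "AE x in \<nu>. f x = 0"
proof -
  have "AE x in \<nu>. f x \<le> 0"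
    using assms by (rule AE_nonpos_if_orthogonal_to_indicators)
  moreover have "AE x in \<nu>. - 1 * f x \<le> 0"
  proof (rule AE_nonpos_if_orthogonal_to_indicators[OF L2_scale[OF f] cover])
    show "L2_inner \<nu> (indicator B) (\<lambda>x. - 1 * f x) = 0"
      if "B \<in> sets \<nu>" "B \<subseteq> A i" for B i
      unfolding L2_inner_scale_right using orth[OF that] by simp
  qed
  ultimately show ?thesis by eventually_elim simp
qed

section \<open>The equivalence\<close>

lemma L2_subset_op_domain: "L2 \<nu> \<subseteq> op_domain \<nu>"
proof
  fix f assume "f \<in> L2 \<nu>"
  moreover have "bounded ((\<lambda>x. 0 :: real) ` space \<nu>)"
    by (rule bounded_subset[of "{0}"]) auto
  ultimately show "f \<in> op_domain \<nu>"
    unfolding op_domain_def by (intro CollectI exI[of _ f] exI[of _ "\<lambda>x. 0"]) auto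
qed

theorem theorem4p9:
  fixes \<mu> \<nu> :: "'a measure"
    and c :: "'a \<Rightarrow> ennreal"
    and P :: "('a \<Rightarrow> real) \<Rightarrow> ('a \<Rightarrow> real)"
  assumes "standard_borel \<mu>"
    and "sigma_finite_measure \<mu>"
    and "non_atomic \<mu>"
    and "c \<in> borel_measurable \<mu>"
    and "AE x in \<mu>. 0 < c x \<and> c x < \<infinity>"
    and "\<And>A. A \<in> B_fin \<mu> \<Longrightarrow> (\<integral>\<^sup>+x\<in>A. c x \<partial>\<mu>) < \<infinity>"
    and "\<nu> = density \<mu> c"
    and "markov_operator \<nu> P"
    and "L2_self_adjoint \<nu> P"
    and "L2_contractive \<nu> P"
    and "invariant_measure \<nu> P"
  shows "(\<not> L2_eigenvalue \<nu> P 1 \<longleftrightarrow> harmonic_functions \<nu> P \<inter> L2 \<nu> = L2_zero \<nu>) \<and>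
    (harmonic_functions \<nu> P \<inter> L2 \<nu> = L2_zero \<nu> \<longleftrightarrow>
       (\<forall>f\<in>L2 \<nu>. (\<lambda>N. L2_norm \<nu> (cesaro_mean P N f)) \<longlonglongrightarrow> 0)) \<and>
    ((\<forall>f\<in>L2 \<nu>. (\<lambda>N. L2_norm \<nu> (cesaro_mean P N f)) \<longlonglongrightarrow> 0) \<longleftrightarrow>
       (\<forall>A\<in>B_fin \<mu>. \<forall>B\<in>B_fin \<mu>. (\<lambda>N. (1 / real N) * (\<Sum>n=1..N. rho \<nu> P n A B)) \<longlonglongrightarrow> 0))"
proof -
  interpret L2_symmetric_contraction \<nu> P
  proof
    show "P f \<in> L2 \<nu>" if "f \<in> L2 \<nu>" for f
      using that assms(9) by (simp add: L2_self_adjoint_def)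
    show "L2_inner \<nu> (P f) g = L2_inner \<nu> f (P g)" if "f \<in> L2 \<nu>" "g \<in> L2 \<nu>" for f g
      using that assms(9) by (simp add: L2_self_adjoint_def)
    show "L2_norm \<nu> (P f) \<le> L2_norm \<nu> f" if "f \<in> L2 \<nu>" for f
      using that assms(10) by (simp add: L2_contractive_def)
    have "linear_operator \<nu> P"
      using assms(8) by (simp add: markov_operator_def positive_operator_def)
    then show "AE x in \<nu>. P (\<lambda>y. a * f y + b * g y) x = a * P f x + b * P g x"
      if "f \<in> L2 \<nu>" "g \<in> L2 \<nu>" for f g a b
      using that L2_subset_op_domain[of \<nu>] unfolding linear_operator_def by blast
  qed
  have sets_eq: "sets \<nu> = sets \<mu>" and space_eq: "space \<nu> = space \<mu>"
    using assms(7) by simp_all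
  \<comment> \<open>The integrability condition on \<open>c\<close> puts the indicators of \<open>B_fin \<mu>\<close> into \<open>L\<^sup>2(\<nu>)\<close>.\<close>
  have fin: "A \<in> sets \<nu>" "emeasure \<nu> A < \<infinity>" if "A \<in> B_fin \<mu>" for A
    using that assms(4,6,7) by (auto simp: B_fin_def emeasure_density)
  let ?no_fixed = "\<forall>f\<in>L2 \<nu>. (AE x in \<nu>. P f x = f x) \<longrightarrow> (AE x in \<nu>. f x = 0)"
  let ?S = "(\<lambda>A. indicator A :: 'a \<Rightarrow> real) ` B_fin \<mu>"
  have i: "\<not> L2_eigenvalue \<nu> P 1 \<longleftrightarrow> ?no_fixed"
    using L2_measurable[of _ \<nu>] unfolding L2_eigenvalue_def L2_zero_def mult_1 by blast
  have ii: "harmonic_functions \<nu> P \<inter> L2 \<nu> = L2_zero \<nu> \<longleftrightarrow> ?no_fixed"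
  proof -
    have "L2_zero \<nu> \<subseteq> harmonic_functions \<nu> P \<inter> L2 \<nu>"
    proof
      fix f assume "f \<in> L2_zero \<nu>"
      then have f: "f \<in> L2 \<nu>" and zero: "AE x in \<nu>. f x = 0"
        using L2_zero_subset[of \<nu>] by (auto simp: L2_zero_def)
      have "AE x in \<nu>. P f x = f x"
        using AE_P_zero[OF f zero] zero by eventually_elim simp
      with f show "f \<in> harmonic_functions \<nu> P \<inter> L2 \<nu>"
        using L2_subset_op_domain[of \<nu>] by (auto simp: harmonic_functions_def)
    qed
    then have "harmonic_functions \<nu> P \<inter> L2 \<nu> = L2_zero \<nu>
        \<longleftrightarrow> harmonic_functions \<nu> P \<inter> L2 \<nu> \<subseteq> L2_zero \<nu>" by blast
    also have "\<dots> \<longleftrightarrow> ?no_fixed"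
      using L2_subset_op_domain[of \<nu>]
        L2_measurable[of _ \<nu>]
      unfolding harmonic_functions_def L2_zero_def by blast
    finally show ?thesis .
  qed
  note iii = cesaro_mean_vanishes_iff_no_fixed
  obtain A :: "nat \<Rightarrow> 'a set" where A: "range A \<subseteq> sets \<mu>" "(\<Union>i. A i) = space \<mu>"
      "\<And>i. emeasure \<mu> (A i) \<noteq> \<infinity>"
    using sigma_finite_measure.sigma_finite[OF assms(2)] by blast
  have A_fin: "B \<in> B_fin \<mu>" if "B \<in> sets \<nu>" "B \<subseteq> A i" for B i
  proof -
    have "emeasure \<mu> B \<le> emeasure \<mu> (A i)"
      using that A(1) by (intro emeasure_mono) auto
    also have "\<dots> < \<infinity>" using A(3)[of i] by (simp add: less_top)
    finally show ?thesis using that sets_eq by (simp add: B_fin_def)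
  qed
  have "?no_fixed \<longleftrightarrow> (\<forall>s\<in>?S. \<forall>t\<in>?S. (\<lambda>N. L2_inner \<nu> s (cesaro_mean P N t)) \<longlonglongrightarrow> 0)"
  proof (rule weak_cesaro_vanishes_iff_no_fixed[symmetric])
    show "?S \<subseteq> L2 \<nu>" using fin by (auto intro: L2_indicator)
    fix f assume f: "f \<in> L2 \<nu>" and orth: "\<And>s. s \<in> ?S \<Longrightarrow> L2_inner \<nu> s f = 0"
    show "AE x in \<nu>. f x = 0"
    proof (rule AE_zero_if_orthogonal_to_indicators[OF f])
      show "range A \<subseteq> sets \<nu>" "(\<Union>i. A i) = space \<nu>"
        using A sets_eq space_eq by auto
      show "emeasure \<nu> (A i) < \<infinity>" for i
        using A(1) sets_eq by (intro fin(2) A_fin[of "A i" i]) auto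
      show "L2_inner \<nu> (indicator B) f = 0" if "B \<in> sets \<nu>" "B \<subseteq> A i" for B i
        using A_fin[OF that] by (intro orth) auto
    qed
  qed
  also have "\<dots> \<longleftrightarrow> (\<forall>A\<in>B_fin \<mu>. \<forall>B\<in>B_fin \<mu>. (\<lambda>N. (1 / real N) * (\<Sum>n=1..N. rho \<nu> P n A B)) \<longlonglongrightarrow> 0)"
    using fin by (simp add: inner_cesaro_mean L2_indicator rho_def)
  finally have iv: "?no_fixed \<longleftrightarrow> \<dots>" .
  show ?thesis
    unfolding i ii iii iv[symmetric] by (intro conjI refl)
qed

end
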